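(* Let $M$ be an $n\times n$ $(0,1)$-matrix such that $M$ or its transpose $M^T$ is equivalent to a matrix of the block form $$\begin{bmatrix} Q & J_{3\times k} & X\\ Y & Z & \ast\end{bmatrix},\qquad Q=\begin{bmatrix}1&0\\0&1\\1&1\end{bmatrix},$$ for some $k\ge 1$, where $X$ is a $3\times(n-k-2)$ $(0,1)$-matrix, $Y$ is an $(n-3)\times 2$ $(0,1)$-matrix, $Z$ is an $(n-3)\times k$ $(0,1)$-matrix, and $\ast$ is an arbitrary $(0,1)$-block. Suppose further that (1) the rows of $X$ are mutually orthogonal, and (2) every column of $Y$ is orthogonal to every column of $Z$. Then $M$ does not support unitaries.
   Context: Two $(0,1)$-matrices $M_1,M_2$ are equivalent if $PM_1P'=M_2$ for some permutation matrices $P,P'$. $J_{3\times k}$ is the $3\times k$ all-ones matrix. Orthogonality of $(0,1)$-vectors means that their usual (real) inner product is $0$. An $n\times n$ $(0,1)$-matrix $M$ supports unitaries if there exists an $n\times n$ complex unitary matrix $U$ such that, for all $i,j$, $U_{ij}\neq 0$ if and only if $M_{ij}=1$. *)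

theory Defs
  imports "Jordan_Normal_Form.Schur_Decomposition" "HOL-Combinatorics.Permutations"
begin

text \<open>
  The \<open>(0,1)\<close>-matrices have real entries, so that orthogonality of rows and columns is
  orthogonality with respect to the real inner product \<^const>\<open>scalar_prod\<close>.
\<close>

definition zero_one_mat :: "nat \<Rightarrow> nat \<Rightarrow> real mat \<Rightarrow> bool" where
  "zero_one_mat nr nc A \<longleftrightarrow> A \<in> carrier_mat nr nc \<and> elements_mat A \<subseteq> {0, 1}"

definition permutation_mat :: "nat \<Rightarrow> real mat \<Rightarrow> bool" where
  "permutation_mat n P \<longleftrightarrow>
     (\<exists>p. p permutes {0..<n} \<and> P = mat n n (\<lambda>(i, j). if j = p i then 1 else 0))"

definition equivalent_mat :: "real mat \<Rightarrow> real mat \<Rightarrow> bool" where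
  "equivalent_mat M\<^sub>1 M\<^sub>2 \<longleftrightarrow>
     (\<exists>P P'. permutation_mat (dim_row M\<^sub>1) P \<and> permutation_mat (dim_col M\<^sub>1) P' \<and>
        P * M\<^sub>1 * P' = M\<^sub>2)"

definition unitary_mat :: "nat \<Rightarrow> complex mat \<Rightarrow> bool" where
  "unitary_mat n U \<longleftrightarrow> U \<in> carrier_mat n n \<and>
     U * mat_adjoint U = 1\<^sub>m n \<and> mat_adjoint U * U = 1\<^sub>m n"

definition supports_unitaries :: "nat \<Rightarrow> real mat \<Rightarrow> bool" where
  "supports_unitaries n M \<longleftrightarrow>
     (\<exists>U. unitary_mat n U \<and> (\<forall>i<n. \<forall>j<n. U $$ (i, j) \<noteq> 0 \<longleftrightarrow> M $$ (i, j) = 1))"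

definition rows_mutually_orthogonal :: "real mat \<Rightarrow> bool" where
  "rows_mutually_orthogonal X \<longleftrightarrow>
     (\<forall>i<dim_row X. \<forall>j<dim_row X. i \<noteq> j \<longrightarrow> row X i \<bullet> row X j = 0)"

definition cols_orthogonal :: "real mat \<Rightarrow> real mat \<Rightarrow> bool" where
  "cols_orthogonal Y Z \<longleftrightarrow>
     (\<forall>i<dim_col Y. \<forall>j<dim_col Z. col Y i \<bullet> col Z j = 0)"

definition Q_mat :: "real mat" where
  "Q_mat = mat_of_rows_list 2 [[1, 0], [0, 1], [1, 1]]"

definition J_mat :: "nat \<Rightarrow> nat \<Rightarrow> real mat" where
  "J_mat nr nc = mat nr nc (\<lambda>_. 1)"

text \<open>Juxtaposition of two matrices with equally many rows; the lower blocks are empty.\<close>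

definition append_cols :: "'a :: zero mat \<Rightarrow> 'a mat \<Rightarrow> 'a mat"  (infixr \<open>@\<^sub>c\<close> 65) where
  "A @\<^sub>c B = four_block_mat A B (0\<^sub>m 0 (dim_col A)) (0\<^sub>m 0 (dim_col B))"

definition block_form :: "nat \<Rightarrow> real mat \<Rightarrow> real mat \<Rightarrow> real mat \<Rightarrow> real mat \<Rightarrow> real mat" where
  "block_form k X Y Z W = (Q_mat @\<^sub>c J_mat 3 k @\<^sub>c X) @\<^sub>r (Y @\<^sub>c Z @\<^sub>c W)"

end

theory Submission
  imports Defs
begin

text \<open>
  Suppose that a unitary \<open>U\<close> has the support of the block matrix, and let \<open>c\<close> be the part of its
  third row that lies in the block of ones, say \<open>c = (c\<^sub>j)\<close>; all entries of \<open>c\<close> are nonzero. The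
  first column of \<open>U\<close> meets the column of \<open>c\<^sub>j\<close> in the first and third row only: the second row is
  excluded by the zero in \<open>Q\<close>, the lower rows by the orthogonality of \<open>Y\<close> and \<open>Z\<close>. Hence
  orthogonality of these two columns makes the part \<open>a\<close> of the first row in the block of ones a
  scalar multiple \<open>\<alpha> c\<close>, with a factor \<open>\<alpha>\<close> that does not depend on \<open>j\<close>. In the same way the second
  column of \<open>U\<close> yields \<open>b = \<beta> c\<close> for the corresponding part of the second row. As \<open>a\<close> and \<open>b\<close> have no
  zero entries, \<open>\<alpha>\<close> and \<open>\<beta>\<close> are nonzero.
  On the other hand, the first two rows of \<open>U\<close> meet only in the block of ones, because the rows of
  \<open>X\<close> have disjoint supports, so their inner product is \<open>\<alpha> (cnj \<beta>) \<parallel>c\<parallel>\<^sup>2\<close>. This is not \<open>0\<close>,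
  because there is at least one \<open>j\<close>: a contradiction.

  The passage from the block matrix to \<open>M\<close> is harmless: unitarity and supports are compatible with
  permutations of rows and columns (\<open>supports_unitaries_equivalent\<close>) and with transposition
  (\<open>supports_unitaries_transpose\<close>).
\<close>

section \<open>Unitarity in terms of entries\<close>

lemma mat_adjoint_index:
  assumes "i < dim_col A" and "j < dim_row A"
  shows "mat_adjoint A $$ (i, j) = conjugate (A $$ (j, i))"
  using assms by (simp add: mat_adjoint_def mat_of_rows_index)

text \<open>
  In this form unitarity is visibly symmetric in rows and columns and insensitive to reindexing.
\<close>

lemma unitary_mat_iff_sums:
  assumes U: "U \<in> carrier_mat n n"
  shows "unitary_mat n U \<longleftrightarrow>
    (\<forall>i<n. \<forall>j<n. (\<Sum>l = 0..<n. U $$ (i, l) * cnj (U $$ (j, l))) = (if i = j then 1 else 0)) \<and>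
    (\<forall>i<n. \<forall>j<n. (\<Sum>l = 0..<n. U $$ (l, i) * cnj (U $$ (l, j))) = (if i = j then 1 else 0))"
    (is "_ \<longleftrightarrow> ?rows \<and> ?cols")
proof -
  have dim: "dim_row (mat_adjoint U) = n" "dim_col (mat_adjoint U) = n"
    using U by (auto simp: mat_adjoint_def)
  have "U * mat_adjoint U = 1\<^sub>m n \<longleftrightarrow> ?rows"
    using U dim by (auto simp: mat_eq_iff scalar_prod_def mat_adjoint_index)
  moreover have "mat_adjoint U * U = 1\<^sub>m n \<longleftrightarrow> 
      (\<forall>i<n. \<forall>j<n. (\<Sum>l = 0..<n. cnj (U $$ (l, i)) * U $$ (l, j)) = (if i = j then 1 else 0))"
    using U dim by (auto simp: mat_eq_iff scalar_prod_def mat_adjoint_index)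
  moreover have "\<dots> \<longleftrightarrow> ?cols"
  proof -
    have swap: "(\<forall>i<n. \<forall>j<n. S j i = (if i = j then 1 else 0)) \<longleftrightarrow>
        (\<forall>i<n. \<forall>j<n. S i j = (if i = j then 1 else 0))" for S :: "nat \<Rightarrow> nat \<Rightarrow> complex"
      by metis
    show ?thesis
      using swap[of "\<lambda>i j. \<Sum>l = 0..<n. U $$ (l, i) * cnj (U $$ (l, j))"]
      by (simp only: mult.commute[of "cnj _"])
  qed
  ultimately show ?thesis
    using U by (simp add: unitary_mat_def)
qed

section \<open>Invariance of supporting unitaries\<close>

lemma supports_unitaries_transpose:
  assumes M: "M \<in> carrier_mat n n" and "supports_unitaries n M"
  shows "supports_unitaries n (transpose_mat M)"
proof -
  obtain U where U: "unitary_mat n U"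
    and supp: "\<forall>i<n. \<forall>j<n. U $$ (i, j) \<noteq> 0 \<longleftrightarrow> M $$ (i, j) = 1"
    using assms(2) unfolding supports_unitaries_def by blast
  have carr: "U \<in> carrier_mat n n"
    using U by (simp add: unitary_mat_def)
  have "unitary_mat n (transpose_mat U)"
    using U carr by (simp add: unitary_mat_iff_sums)
  moreover have "\<forall>i<n. \<forall>j<n. transpose_mat U $$ (i, j) \<noteq> 0 \<longleftrightarrow> transpose_mat M $$ (i, j) = 1"
    using supp carr M by auto
  ultimately show ?thesis
    unfolding supports_unitaries_def by blast
qed

lemma equivalent_mat_reindex:
  assumes M: "M \<in> carrier_mat n n" and "equivalent_mat M N"
  obtains p q where "p permutes {0..<n}" and "q permutes {0..<n}"
    and "\<And>i j. i < n \<Longrightarrow> j < n \<Longrightarrow> N $$ (i, j) = M $$ (p i, q j)"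
proof -
  obtain p p' where p: "p permutes {0..<n}" and p': "p' permutes {0..<n}"
    and N: "N = mat n n (\<lambda>(i, j). if j = p i then 1 else 0) * M *
      mat n n (\<lambda>(i, j). if j = p' i then 1 else 0)"
    using assms unfolding equivalent_mat_def permutation_mat_def by auto
  \<comment> \<open>A permutation matrix acts on columns through the inverse permutation.\<close>
  define q where "q = inv_into UNIV p'"
  have q: "q permutes {0..<n}" and q_eq: "q j = l \<longleftrightarrow> j = p' l" for j l
    using permutes_inv[OF p'] permutes_inv_eq[OF p'] by (auto simp: q_def)
  have "N $$ (i, j) = M $$ (p i, q j)" if ij: "i < n" "j < n" for i j
  proof -
    have pi: "p i < n"
      using permutes_in_image[OF p, of i] ij by simp
    have qj: "q j < n"
      using permutes_in_image[OF q, of j] ij by simp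
    have left: "(mat n n (\<lambda>(i, j). if j = p i then 1 else 0) * M) $$ (i, l) = M $$ (p i, l)"
      if "l < n" for l
      using M ij pi that by (simp add: scalar_prod_def if_distrib[of "\<lambda>x. x * _"] cong: if_cong)
    have "N $$ (i, j) = (\<Sum>l = 0..<n. M $$ (p i, l) * (if j = p' l then 1 else 0))"
      using M ij left unfolding N by (subst index_mult_mat) (auto simp: scalar_prod_def intro!: sum.cong)
    also have "\<dots> = (\<Sum>l = 0..<n. if l = q j then M $$ (p i, l) else 0)"
      by (intro sum.cong refl) (auto simp flip: q_eq)
    also have "\<dots> = M $$ (p i, q j)"
      using qj by simp
    finally show ?thesis .
  qed
  then show ?thesis
    using that p q by blast
qed

lemma supports_unitaries_equivalent:
  assumes M: "M \<in> carrier_mat n n" and "equivalent_mat M N" and "supports_unitaries n M"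
  shows "supports_unitaries n N"
proof -
  obtain U where U: "unitary_mat n U"
    and supp: "\<forall>i<n. \<forall>j<n. U $$ (i, j) \<noteq> 0 \<longleftrightarrow> M $$ (i, j) = 1"
    using assms(3) unfolding supports_unitaries_def by blast
  have carr: "U \<in> carrier_mat n n"
    using U by (simp add: unitary_mat_def)
  obtain p q where p: "p permutes {0..<n}" and q: "q permutes {0..<n}"
    and N: "\<And>i j. i < n \<Longrightarrow> j < n \<Longrightarrow> N $$ (i, j) = M $$ (p i, q j)"
    using equivalent_mat_reindex[OF M assms(2)] by blast
  have p_less: "p i < n" and q_less: "q i < n" if "i < n" for i
    using permutes_in_image[OF p, of i] permutes_in_image[OF q, of i] that by simp_all
  have p_eq: "p i = p j \<longleftrightarrow> i = j" and q_eq: "q i = q j \<longleftrightarrow> i = j" for i j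
    using permutes_inj[OF p] permutes_inj[OF q] by (auto simp: inj_eq)
  define V where "V = mat n n (\<lambda>(i, j). U $$ (p i, q j))"
  have "(\<Sum>l = 0..<n. V $$ (i, l) * cnj (V $$ (j, l))) = (if i = j then 1 else 0)"
    if "i < n" "j < n" for i j
  proof -
    have "(\<Sum>l = 0..<n. V $$ (i, l) * cnj (V $$ (j, l))) =
        (\<Sum>l = 0..<n. U $$ (p i, q l) * cnj (U $$ (p j, q l)))"
      using that by (simp add: V_def)
    also have "\<dots> = (\<Sum>l = 0..<n. U $$ (p i, l) * cnj (U $$ (p j, l)))"
      using sum.permute[OF q, of "\<lambda>l. U $$ (p i, l) * cnj (U $$ (p j, l))"] by (simp add: comp_def)
    finally show ?thesis
      using U that by (simp add: unitary_mat_iff_sums[OF carr] p_less p_eq)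
  qed
  moreover have "(\<Sum>l = 0..<n. V $$ (l, i) * cnj (V $$ (l, j))) = (if i = j then 1 else 0)"
    if "i < n" "j < n" for i j
  proof -
    have "(\<Sum>l = 0..<n. V $$ (l, i) * cnj (V $$ (l, j))) =
        (\<Sum>l = 0..<n. U $$ (p l, q i) * cnj (U $$ (p l, q j)))"
      using that by (simp add: V_def)
    also have "\<dots> = (\<Sum>l = 0..<n. U $$ (l, q i) * cnj (U $$ (l, q j)))"
      using sum.permute[OF p, of "\<lambda>l. U $$ (l, q i) * cnj (U $$ (l, q j))"] by (simp add: comp_def)
    finally show ?thesis
      using U that by (simp add: unitary_mat_iff_sums[OF carr] q_less q_eq)
  qed
  ultimately have "unitary_mat n V"
    by (subst unitary_mat_iff_sums) (auto simp: V_def)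
  moreover have "\<forall>i<n. \<forall>j<n. V $$ (i, j) \<noteq> 0 \<longleftrightarrow> N $$ (i, j) = 1"
    using supp N by (simp add: V_def p_less q_less)
  ultimately show ?thesis
    unfolding supports_unitaries_def by blast
qed

section \<open>The obstruction\<close>

lemma zero_one_mat_entry_nonneg:
  assumes "zero_one_mat nr nc A" and "i < nr" and "j < nc"
  shows "A $$ (i, j) \<ge> 0"
proof -
  have "A $$ (i, j) \<in> elements_mat A"
    using assms unfolding zero_one_mat_def by (intro elements_matI) auto
  then show ?thesis
    using assms(1) unfolding zero_one_mat_def by auto
qed

text \<open>
  A vanishing sum of nonnegative terms has only zero terms. This turns the two orthogonality
  hypotheses on the blocks into disjointness of supports, which carries over to \<open>U\<close>.
\<close>

lemma nonneg_scalar_prod_eq_0D: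
  fixes v w :: "real vec"
  assumes "v \<bullet> w = 0" and "dim_vec v = m" and "dim_vec w = m"
    and "\<And>i. i < m \<Longrightarrow> v $ i \<ge> 0" and "\<And>i. i < m \<Longrightarrow> w $ i \<ge> 0" and "i < m"
  shows "v $ i = 0 \<or> w $ i = 0"
proof -
  have "(\<Sum>l = 0..<m. v $ l * w $ l) = 0"
    using assms(1,3) by (simp add: scalar_prod_def)
  then have "v $ i * w $ i = 0"
    using assms(4-6) by (subst (asm) sum_nonneg_eq_0_iff) auto
  then show ?thesis
    by simp
qed

lemma block_form_index:
  assumes "X \<in> carrier_mat 3 (n - k - 2)" and "Y \<in> carrier_mat (n - 3) 2"
    and "Z \<in> carrier_mat (n - 3) k" and "W \<in> carrier_mat (n - 3) (n - k - 2)"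
    and "k + 2 \<le> n" and "3 \<le> n" and "i < n" and "j < n"
  shows "block_form k X Y Z W $$ (i, j) =
    (if i < 3
     then if j < 2 then Q_mat $$ (i, j) else if j < k + 2 then 1 else X $$ (i, j - 2 - k)
     else if j < 2 then Y $$ (i - 3, j) else if j < k + 2 then Z $$ (i - 3, j - 2)
       else W $$ (i - 3, j - 2 - k))"
proof -
  have [simp]: "dim_row Q_mat = 3" "dim_col Q_mat = 2"
    by (simp_all add: Q_mat_def mat_of_rows_list_def)
  have [simp]: "dim_row X = 3" "dim_col X = n - k - 2" "dim_row Y = n - 3" "dim_col Y = 2"
    "dim_row Z = n - 3" "dim_col Z = k" "dim_row W = n - 3" "dim_col W = n - k - 2"
    using assms(1-4) by auto
  show ?thesis
    using assms(5-8) by (auto simp: block_form_def append_rows_def append_cols_def J_mat_def numeral_2_eq_2)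
qed

text \<open>
  The linear algebra of the contradiction: if \<open>a\<close> and \<open>b\<close> are both nonzero multiples of \<open>c\<close>, then
  their inner product is a nonzero multiple of \<open>\<parallel>c\<parallel>\<^sup>2\<close>. The two proportionality hypotheses have the
  shape in which orthogonality of columns delivers them.
\<close>

lemma sum_mult_cnj_nonzero_of_proportional:
  fixes a b c :: "'a \<Rightarrow> complex"
  assumes "finite J" and "J \<noteq> {}"
    and "s \<noteq> 0" "s' \<noteq> 0" "t \<noteq> 0" "t' \<noteq> 0"
    and c: "\<And>j. j \<in> J \<Longrightarrow> c j \<noteq> 0"
    and a: "\<And>j. j \<in> J \<Longrightarrow> a j * cnj s + c j * cnj s' = 0"
    and b: "\<And>j. j \<in> J \<Longrightarrow> b j * cnj t + c j * cnj t' = 0"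
  shows "(\<Sum>j\<in>J. a j * cnj (b j)) \<noteq> 0"
proof -
  define \<alpha> where "\<alpha> = - cnj s' / cnj s"
  define \<beta> where "\<beta> = - cnj t' / cnj t"
  have "a j = \<alpha> * c j" "b j = \<beta> * c j" if "j \<in> J" for j
    using a[OF that] b[OF that] assms(3,5)
    by (simp_all add: \<alpha>_def \<beta>_def field_simps eq_neg_iff_add_eq_0)
  then have "(\<Sum>j\<in>J. a j * cnj (b j)) = (\<Sum>j\<in>J. \<alpha> * cnj \<beta> * complex_of_real ((cmod (c j))\<^sup>2))"
    by (intro sum.cong refl) (simp flip: complex_norm_square)
  also have "\<dots> = \<alpha> * cnj \<beta> * complex_of_real (\<Sum>j\<in>J. (cmod (c j))\<^sup>2)"
    by (simp add: sum_distrib_left)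
  finally have sum_eq: "(\<Sum>j\<in>J. a j * cnj (b j)) = \<dots>" .
  have "(\<Sum>j\<in>J. (cmod (c j))\<^sup>2) > 0"
    using assms(1,2) c by (intro sum_pos) auto
  then have "complex_of_real (\<Sum>j\<in>J. (cmod (c j))\<^sup>2) \<noteq> 0"
    by (simp only: of_real_eq_0_iff)
  moreover have "\<alpha> \<noteq> 0" "\<beta> \<noteq> 0"
    using assms(3-6) by (simp_all add: \<alpha>_def \<beta>_def)
  ultimately show ?thesis
    unfolding sum_eq by simp
qed

lemma block_form_not_supports_unitaries:
  assumes k: "1 \<le> k" "k + 2 \<le> n" "3 \<le> n"
    and X: "zero_one_mat 3 (n - k - 2) X" and Y: "zero_one_mat (n - 3) 2 Y"
    and Z: "zero_one_mat (n - 3) k Z" and W: "W \<in> carrier_mat (n - 3) (n - k - 2)"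
    and X_orth: "rows_mutually_orthogonal X" and YZ_orth: "cols_orthogonal Y Z"
  shows "\<not> supports_unitaries n (block_form k X Y Z W)"
proof
  let ?B = "block_form k X Y Z W"
  assume "supports_unitaries n ?B"
  then obtain U where U: "unitary_mat n U"
    and supp: "\<And>i j. i < n \<Longrightarrow> j < n \<Longrightarrow> U $$ (i, j) \<noteq> 0 \<longleftrightarrow> ?B $$ (i, j) = 1"
    unfolding supports_unitaries_def by blast
  have carr: "U \<in> carrier_mat n n"
    using U by (simp add: unitary_mat_def)
  have dims: "X \<in> carrier_mat 3 (n - k - 2)" "Y \<in> carrier_mat (n - 3) 2" "Z \<in> carrier_mat (n - 3) k"
    using X Y Z by (simp_all add: zero_one_mat_def)
  note B = block_form_index[OF dims W k(2,3)]
  have Q: "Q_mat $$ (0, 0) = 1" "Q_mat $$ (0, Suc 0) = 0" "Q_mat $$ (Suc 0, 0) = 0"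
    "Q_mat $$ (Suc 0, Suc 0) = 1" "Q_mat $$ (2, 0) = 1" "Q_mat $$ (2, Suc 0) = 1"
    by (simp_all add: Q_mat_def mat_of_rows_list_def)
  have ones: "U $$ (i, j) \<noteq> 0" if "i < 3" "j \<in> {2..<k + 2}" for i j
    using supp[of i j] B[of i j] k that by auto
  have U_Q: "U $$ (0, 0) \<noteq> 0" "U $$ (0, 1) = 0" "U $$ (1, 0) = 0" "U $$ (1, 1) \<noteq> 0"
    "U $$ (2, 0) \<noteq> 0" "U $$ (2, 1) \<noteq> 0"
    using supp[of 0 0] supp[of 0 1] supp[of 1 0] supp[of 1 1] supp[of 2 0] supp[of 2 1] k Q
    by (simp_all add: B)
  have X_disjoint: "U $$ (0, j) * cnj (U $$ (1, j)) = 0" if "j \<in> {k + 2..<n}" for j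
  proof -
    have "row X 0 \<bullet> row X 1 = 0"
      using X_orth dims by (auto simp: rows_mutually_orthogonal_def)
    then have "row X 0 $ (j - 2 - k) = 0 \<or> row X 1 $ (j - 2 - k) = 0"
      by (rule nonneg_scalar_prod_eq_0D[where m = "n - k - 2"])
        (use dims that zero_one_mat_entry_nonneg[OF X] in auto)
    then have "X $$ (0, j - 2 - k) = 0 \<or> X $$ (1, j - 2 - k) = 0"
      using dims that by auto
    then show ?thesis
      using supp[of 0 j] supp[of 1 j] k that by (auto simp: B)
  qed
  have YZ_disjoint: "U $$ (l, j) * cnj (U $$ (l, e)) = 0"
    if "l \<in> {3..<n}" "j \<in> {2..<k + 2}" "e < 2" for l j e
  proof -
    have "col Y e \<bullet> col Z (j - 2) = 0"
      using YZ_orth dims that by (auto simp: cols_orthogonal_def)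
    then have "col Y e $ (l - 3) = 0 \<or> col Z (j - 2) $ (l - 3) = 0"
      by (rule nonneg_scalar_prod_eq_0D[where m = "n - 3"])
        (use dims that zero_one_mat_entry_nonneg[OF Y] zero_one_mat_entry_nonneg[OF Z] in auto)
    then have "Y $$ (l - 3, e) = 0 \<or> Z $$ (l - 3, j - 2) = 0"
      using dims that by auto
    then show ?thesis
      using supp[of l e] supp[of l j] k that by (auto simp: B)
  qed
  have cols: "U $$ (0, j) * cnj (U $$ (0, e)) + U $$ (1, j) * cnj (U $$ (1, e)) +
      U $$ (2, j) * cnj (U $$ (2, e)) = 0" if j: "j \<in> {2..<k + 2}" and e: "e < 2" for j e
  proof -
    have "0 = (\<Sum>l = 0..<n. U $$ (l, j) * cnj (U $$ (l, e)))"
      using U carr k j e by (auto simp: unitary_mat_iff_sums)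
    also have "\<dots> = (\<Sum>l = 0..<3. U $$ (l, j) * cnj (U $$ (l, e)))"
      using k YZ_disjoint[OF _ j e] by (intro sum.mono_neutral_right) auto
    finally show ?thesis
      by (simp add: numeral_3_eq_3 numeral_2_eq_2)
  qed
  have "0 = (\<Sum>j = 0..<n. U $$ (0, j) * cnj (U $$ (1, j)))"
    using U carr k by (auto simp: unitary_mat_iff_sums)
  also have "\<dots> = (\<Sum>j = 2..<k + 2. U $$ (0, j) * cnj (U $$ (1, j)))"
  proof (intro sum.mono_neutral_right ballI)
    fix j assume "j \<in> {0..<n} - {2..<k + 2}"
    then consider "j = 0" | "j = 1" | "j \<in> {k + 2..<n}"
      by fastforce
    then show "U $$ (0, j) * cnj (U $$ (1, j)) = 0"
      by cases (use U_Q X_disjoint in auto)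
  qed (use k in auto)
  also have "\<dots> \<noteq> 0"
  proof (rule sum_mult_cnj_nonzero_of_proportional)
    show "U $$ (0, j) * cnj (U $$ (0, 0)) + U $$ (2, j) * cnj (U $$ (2, 0)) = 0"
      if "j \<in> {2..<k + 2}" for j
      using cols[OF that, of 0] U_Q by simp
    show "U $$ (1, j) * cnj (U $$ (1, 1)) + U $$ (2, j) * cnj (U $$ (2, 1)) = 0"
      if "j \<in> {2..<k + 2}" for j
      using cols[OF that, of 1] U_Q by simp
  qed (use k U_Q ones in auto)
  finally show False
    by simp
qed

theorem theorem3p1:
  fixes n k :: nat and M X Y Z W :: "real mat"
  assumes "zero_one_mat n n M"
    and "1 \<le> k" and "k + 2 \<le> n" and "3 \<le> n"
    and "zero_one_mat 3 (n - k - 2) X"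
    and "zero_one_mat (n - 3) 2 Y"
    and "zero_one_mat (n - 3) k Z"
    and "zero_one_mat (n - 3) (n - k - 2) W"
    and "equivalent_mat M (block_form k X Y Z W) \<or>
         equivalent_mat (transpose_mat M) (block_form k X Y Z W)"
    and "rows_mutually_orthogonal X"
    and "cols_orthogonal Y Z"
  shows "\<not> supports_unitaries n M"
proof
  assume supp: "supports_unitaries n M"
  have M: "M \<in> carrier_mat n n" and W: "W \<in> carrier_mat (n - 3) (n - k - 2)"
    using assms(1,8) by (simp_all add: zero_one_mat_def)
  have "supports_unitaries n (block_form k X Y Z W)"
    using assms(9)
  proof
    assume "equivalent_mat M (block_form k X Y Z W)"
    then show ?thesis
      using supports_unitaries_equivalent[OF M] supp by blast
  next
    assume "equivalent_mat (transpose_mat M) (block_form k X Y Z W)"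
    then show ?thesis
      using supports_unitaries_equivalent[of "transpose_mat M" n] M
        supports_unitaries_transpose[OF M supp] by simp
  qed
  then show False
    using block_form_not_supports_unitaries[OF assms(2-7) W assms(10,11)] by blast
qed

end
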